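(* Let $P$ be a metric space, let $\mathbb X$ and $\mathbb Y$ be (real) Banach spaces, and let $F:P\times\mathbb X\rightrightarrows\mathbb Y$ be a set-valued mapping with $F(p,x)\ne\varnothing$ for all $(p,x)\in P\times\mathbb X$. Let $C\subseteq\mathbb Y$ be a (nonempty) closed convex cone, let $S(p)=\{x\in\mathbb X:F(p,x)\subseteq C\}$ for $p\in P$, and $\varphi_F(p,x)=\sup_{y\in F(p,x)}\mathrm{dist}(y,C)$. Let $\bar p\in P$ and $\bar x\in S(\bar p)$. Suppose that, for some $\delta>0$ and every $p\in B(\bar p,\delta)$, the set-valued mapping $F(p,\cdot):\mathbb X\rightrightarrows\mathbb Y$ is lower semicontinuous, concave and bounded-valued away from $C$ on $\mathbb X$. (i) If $F$ is metrically $C$-increasing with respect to $x$ around $(\bar p,\bar x)$, uniformly in $p$, with exact uniform bound $\mathrm{inc}\,F_x(\bar p,\bar x)$, then $$\overline{|\nabla_x\varphi_F|}{}^{>}(\bar p,\bar x)\ge\mathrm{inc}\,F_x(\bar p,\bar x)-1>0.$$ (ii) If $F(\bar p,\cdot)$ is metrically $C$-increasing around $\bar x$, with exact bound $\mathrm{inc}\,F(\bar p,\cdot)(\bar x)$, then $$\overline{|\nabla\varphi_F(\bar p,\cdot)|}{}^{>}(\bar x)\ge\mathrm{inc}\,F(\bar p,\cdot)(\bar x)-1>0.$$ (iii) If $F(\bar p,\cdot)$ is metrically $C$-increasing on $\mathbb X$, with exact bound $\mathrm{inc}\,F(\bar p,\cdot)$, then $$\tau_{\bar p}\ge\mathrm{inc}\,F(\bar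 p,\cdot)-1>0.$$
   Context: $B(x,r)$ is the closed ball of center $x$ and radius $r$; $\mathrm{dist}(x,A)=\inf_{a\in A}d(x,a)$; $B(A,r)=\{x:\mathrm{dist}(x,A)\le r\}$. A set-valued mapping $\Phi:\mathbb X\rightrightarrows\mathbb Y$ is: - lower semicontinuous (l.s.c.) at $x_0$ if for every open $O\subseteq\mathbb Y$ with $\Phi(x_0)\cap O\neq\varnothing$ there is a neighbourhood $U$ of $x_0$ with $\Phi(x)\cap O\ne\varnothing$ for all $x\in U$ (and l.s.c. on $\mathbb X$ if this holds at every point); - concave on $\mathbb X$ if $\Phi(tx_1+(1-t)x_2)\subseteq t\Phi(x_1)+(1-t)\Phi(x_2)$ for all $x_1,x_2\in\mathbb X$, $t\in[0,1]$; - bounded-valued away from $C$ on $\mathbb X$ if $\Phi(x)\setminus C$ is bounded for every $x\in\mathbb X$; - metrically $C$-increasing on $\mathbb X$ if there is $\alpha>1$ such that for all $x\in\mathbb X$ and $r>0$ there is $u\in B(x,r)$ with $B(\Phi(u),\alpha r)\subseteq B(\Phi(x)+C,r)$; the exact bound $\mathrm{inc}\,\Phi$ is the supremum of all such $\alpha>1$; - metrically $C$-increasing around $\bar x$ if there are $\delta>0$ and $\alpha>1$ such that for all $x\in B(\bar x,\delta)$ and $r\in(0,\delta)$ there is $u\in B(x,r)$ with $B(\Phi(u),\alpha r)\subseteq B(\Phi(x)+C,r)$; the exact bound $\mathrm{inc}\,\Phi(\bar x)$ is the supremum of all $\alpha>1$ for which such a $\delta>0$ exists. $F:P\times\mathbb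 X\rightrightarrows\mathbb Y$ is metrically $C$-increasing with respect to $x$ around $(\bar p,\bar x)$, uniformly in $p$, if there are $\delta>0$ and $\alpha>1$ such that for all $(p,x)\in B(\bar p,\delta)\times B(\bar x,\delta)$ and $r\in(0,\delta)$ there is $u\in B(x,r)$ with $B(F(p,u),\alpha r)\subseteq B(F(p,x)+C,r)$; the exact uniform bound $\mathrm{inc}\,F_x(\bar p,\bar x)$ is the supremum of all $\alpha>1$ for which such a $\delta>0$ exists. The strong slope of $\psi:\mathbb X\to\mathbb R\cup\{\pm\infty\}$ at a point $x$ with $\psi(x)\in\mathbb R$ is $|\nabla\psi|(x)=0$ if $x$ is a local minimizer of $\psi$, and $|\nabla\psi|(x)=\limsup_{z\to x}\frac{\psi(x)-\psi(z)}{\|z-x\|}$ otherwise. Set $$\overline{|\nabla\psi|}{}^{>}(\bar x)=\lim_{\epsilon\to0^+}\inf\{|\nabla\psi|(x):x\in B(\bar x,\epsilon),\ \psi(\bar x)<\psi(x)<\psi(\bar x)+\epsilon\},$$ $$\overline{|\nabla_x\varphi_F|}{}^{>}(\bar p,\bar x)=\lim_{\epsilon\to0^+}\inf\{|\nabla\varphi_F(p,\cdot)|(x):(p,x)\in B(\bar p,\epsilon)\times B(\bar x,\epsilon),\ \varphi_F(\bar p,\bar x)<\varphi_F(p,x)<\varphi_F(\bar p,\bar x)+\epsilon\},$$ $$\tau_{\bar p}=\inf\{|\nabla\varphi_F(\bar p,\cdot)|(x): x\in\mathbb X\setminus S(\bar p)\},$$ with $\inf\varnothing=+\infty$. *)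

theory Defs
  imports "HOL-Analysis.Analysis"
begin

text \<open>
  Set-valued mappings are functions into sets, and Minkowski sums of sets are written
  with the addition on sets from \<^theory>\<open>HOL-Library.Set_Algebras\<close>.
  All quantities that may be infinite live in \<^typ>\<open>ereal\<close>, where the infimum of the empty
  set is infinity.
\<close>

text \<open>
  The closed enlargement $B(A,r)$ of a set. Since \<^term>\<open>infdist y {} = 0\<close> in the library
  (and not infinity), this is meant for nonempty \<open>A\<close> only.
\<close>

definition enlarge :: "'a::metric_space set \<Rightarrow> real \<Rightarrow> 'a set" where
  "enlarge A r = {y. infdist y A \<le> r}"

definition lsc_at :: "('x::topological_space \<Rightarrow> 'y::topological_space set) \<Rightarrow> 'x \<Rightarrow> bool" where
  "lsc_at \<Phi> x0 \<longleftrightarrow>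
     (\<forall>O'. open O' \<and> \<Phi> x0 \<inter> O' \<noteq> {} \<longrightarrow> (\<forall>\<^sub>F x in nhds x0. \<Phi> x \<inter> O' \<noteq> {}))"

definition lsc :: "('x::topological_space \<Rightarrow> 'y::topological_space set) \<Rightarrow> bool" where
  "lsc \<Phi> \<longleftrightarrow> (\<forall>x. lsc_at \<Phi> x)"

definition concave_map :: "('x::real_vector \<Rightarrow> 'y::real_vector set) \<Rightarrow> bool" where
  "concave_map \<Phi> \<longleftrightarrow>
     (\<forall>x1 x2. \<forall>t\<in>{0..1}. \<Phi> (t *\<^sub>R x1 + (1 - t) *\<^sub>R x2)
        \<subseteq> (\<lambda>y. t *\<^sub>R y) ` \<Phi> x1 + (\<lambda>y. (1 - t) *\<^sub>R y) ` \<Phi> x2)"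

definition bounded_valued_away :: "'y::metric_space set \<Rightarrow> ('x \<Rightarrow> 'y set) \<Rightarrow> bool" where
  "bounded_valued_away C \<Phi> \<longleftrightarrow> (\<forall>x. bounded (\<Phi> x - C))"


text \<open>
  Metric increase. The predicate \<open>incr_step\<close> is the inner condition shared by the global,
  the local and the uniform local notion.
\<close>

definition incr_step ::
    "'y::real_normed_vector set \<Rightarrow> ('x::metric_space \<Rightarrow> 'y set) \<Rightarrow> real \<Rightarrow> 'x \<Rightarrow> real \<Rightarrow> bool" where
  "incr_step C \<Phi> \<alpha> x r \<longleftrightarrow>
     (\<exists>u\<in>cball x r. enlarge (\<Phi> u) (\<alpha> * r) \<subseteq> enlarge (\<Phi> x + C) r)"

definition incr_bounds ::
    "'y::real_normed_vector set \<Rightarrow> ('x::metric_space \<Rightarrow> 'y set) \<Rightarrow> real set" where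
  "incr_bounds C \<Phi> = {\<alpha>. \<alpha> > 1 \<and> (\<forall>x. \<forall>r>0. incr_step C \<Phi> \<alpha> x r)}"

definition metrically_increasing ::
    "'y::real_normed_vector set \<Rightarrow> ('x::metric_space \<Rightarrow> 'y set) \<Rightarrow> bool" where
  "metrically_increasing C \<Phi> \<longleftrightarrow> incr_bounds C \<Phi> \<noteq> {}"

definition inc ::
    "'y::real_normed_vector set \<Rightarrow> ('x::metric_space \<Rightarrow> 'y set) \<Rightarrow> ereal" where
  "inc C \<Phi> = (SUP \<alpha>\<in>incr_bounds C \<Phi>. ereal \<alpha>)"

definition incr_bounds_around ::
    "'y::real_normed_vector set \<Rightarrow> ('x::metric_space \<Rightarrow> 'y set) \<Rightarrow> 'x \<Rightarrow> real set" where
  "incr_bounds_around C \<Phi> xb =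
     {\<alpha>. \<alpha> > 1 \<and> (\<exists>\<delta>>0. \<forall>x\<in>cball xb \<delta>. \<forall>r\<in>{0<..<\<delta>}. incr_step C \<Phi> \<alpha> x r)}"

definition metrically_increasing_around ::
    "'y::real_normed_vector set \<Rightarrow> ('x::metric_space \<Rightarrow> 'y set) \<Rightarrow> 'x \<Rightarrow> bool" where
  "metrically_increasing_around C \<Phi> xb \<longleftrightarrow> incr_bounds_around C \<Phi> xb \<noteq> {}"

definition inc_around ::
    "'y::real_normed_vector set \<Rightarrow> ('x::metric_space \<Rightarrow> 'y set) \<Rightarrow> 'x \<Rightarrow> ereal" where
  "inc_around C \<Phi> xb = (SUP \<alpha>\<in>incr_bounds_around C \<Phi> xb. ereal \<alpha>)"

definition incr_bounds_uniform ::
    "'y::real_normed_vector set \<Rightarrow> ('p::metric_space \<Rightarrow> 'x::metric_space \<Rightarrow> 'y set) \<Rightarrow> 'p \<Rightarrow> 'x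
      \<Rightarrow> real set" where
  "incr_bounds_uniform C F pb xb =
     {\<alpha>. \<alpha> > 1 \<and> (\<exists>\<delta>>0. \<forall>(p, x)\<in>cball pb \<delta> \<times> cball xb \<delta>. \<forall>r\<in>{0<..<\<delta>}. incr_step C (F p) \<alpha> x r)}"

definition metrically_increasing_uniform ::
    "'y::real_normed_vector set \<Rightarrow> ('p::metric_space \<Rightarrow> 'x::metric_space \<Rightarrow> 'y set) \<Rightarrow> 'p \<Rightarrow> 'x
      \<Rightarrow> bool" where
  "metrically_increasing_uniform C F pb xb \<longleftrightarrow> incr_bounds_uniform C F pb xb \<noteq> {}"

definition inc_uniform ::
    "'y::real_normed_vector set \<Rightarrow> ('p::metric_space \<Rightarrow> 'x::metric_space \<Rightarrow> 'y set) \<Rightarrow> 'p \<Rightarrow> 'x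
      \<Rightarrow> ereal" where
  "inc_uniform C F pb xb = (SUP \<alpha>\<in>incr_bounds_uniform C F pb xb. ereal \<alpha>)"


definition sol :: "'y set \<Rightarrow> ('p \<Rightarrow> 'x \<Rightarrow> 'y set) \<Rightarrow> 'p \<Rightarrow> 'x set" where
  "sol C F p = {x. F p x \<subseteq> C}"

definition excess :: "'y::metric_space set \<Rightarrow> ('p \<Rightarrow> 'x \<Rightarrow> 'y set) \<Rightarrow> 'p \<Rightarrow> 'x \<Rightarrow> ereal" where
  "excess C F p x = (SUP y\<in>F p x. ereal (infdist y C))"


text \<open>
  The strong slope is only meaningful at points where \<open>\<psi>\<close> is finite.
\<close>

definition strong_slope :: "('x::real_normed_vector \<Rightarrow> ereal) \<Rightarrow> 'x \<Rightarrow> ereal" where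
  "strong_slope \<psi> x =
     (if \<forall>\<^sub>F z in nhds x. \<psi> x \<le> \<psi> z then 0
      else Limsup (at x) (\<lambda>z. (\<psi> x - \<psi> z) / ereal (norm (z - x))))"

text \<open>
  In both strict outer slopes the infimum is antitone in \<open>\<epsilon>\<close>, so the limit exists
  in \<^typ>\<open>ereal\<close> (lemma \<open>tendsto_at_right_antimono_ereal\<close> below).
\<close>

definition outer_slope :: "('x::real_normed_vector \<Rightarrow> ereal) \<Rightarrow> 'x \<Rightarrow> ereal" where
  "outer_slope \<psi> xb =
     Lim (at_right 0) (\<lambda>\<epsilon>::real.
       INF x\<in>{x \<in> cball xb \<epsilon>. \<psi> xb < \<psi> x \<and> \<psi> x < \<psi> xb + ereal \<epsilon>}. strong_slope \<psi> x)"

definition partial_outer_slope ::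
    "('p::metric_space \<Rightarrow> 'x::real_normed_vector \<Rightarrow> ereal) \<Rightarrow> 'p \<Rightarrow> 'x \<Rightarrow> ereal" where
  "partial_outer_slope \<phi> pb xb =
     Lim (at_right 0) (\<lambda>\<epsilon>::real.
       INF (p, x)\<in>{(p, x) \<in> cball pb \<epsilon> \<times> cball xb \<epsilon>.
                     \<phi> pb xb < \<phi> p x \<and> \<phi> p x < \<phi> pb xb + ereal \<epsilon>}. strong_slope (\<phi> p) x)"

definition tau :: "'y::metric_space set \<Rightarrow> ('p \<Rightarrow> 'x::real_normed_vector \<Rightarrow> 'y set) \<Rightarrow> 'p \<Rightarrow> ereal" where
  "tau C F p = (INF x\<in>UNIV - sol C F p. strong_slope (excess C F p) x)"

lemma tendsto_at_right_antimono_ereal: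
  fixes f :: "real \<Rightarrow> ereal"
  assumes anti: "\<And>a b. 0 < a \<Longrightarrow> a \<le> b \<Longrightarrow> f b \<le> f a"
  shows "(f \<longlongrightarrow> (SUP \<epsilon>\<in>{0<..}. f \<epsilon>)) (at_right 0)"
proof (rule order_tendstoI)
  fix l assume "l < (SUP \<epsilon>\<in>{0<..}. f \<epsilon>)"
  then obtain b where b: "b > 0" "l < f b"
    by (auto simp: less_SUP_iff)
  then show "\<forall>\<^sub>F x in at_right 0. l < f x"
    unfolding eventually_at_right_field
    by (intro exI[of _ b]) (auto intro: less_le_trans anti less_imp_le)
next
  fix u assume u: "(SUP \<epsilon>\<in>{0<..}. f \<epsilon>) < u"
  show "\<forall>\<^sub>F x in at_right 0. f x < u"
    unfolding eventually_at_right_field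
    using u by (intro exI[of _ 1]) (auto intro: le_less_trans[OF SUP_upper])
qed

end

theory Submission
  imports Defs
begin

text \<open>
  Enlarging a set not contained in a convex set \<open>C\<close> by \<open>\<rho>\<close> increases its excess over \<open>C\<close> by at
  least \<open>\<rho>\<close>. Hence the inclusion in the definition of metric increase at \<open>x\<close> gives
  \<open>\<phi> u + \<alpha> r \<le> \<phi> x + r\<close> for some \<open>u\<close> within distance \<open>r\<close> of \<open>x\<close>, as soon as \<open>\<Phi> u\<close> is not
  contained in \<open>C\<close>; lower semicontinuity ensures this for small \<open>r\<close>. Letting \<open>r\<close> tend to \<open>0\<close>, the
  strong slope of \<open>\<phi>\<close> at \<open>x\<close> is at least \<open>\<alpha> - 1\<close>.
\<close>

section \<open>Distance to a convex set and to a convex cone\<close>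

lemma infdist_greatest:
  fixes x :: "'a::metric_space"
  assumes "A \<noteq> {}" "\<And>a. a \<in> A \<Longrightarrow> d \<le> dist x a"
  shows "d \<le> infdist x A"
  using assms by (auto simp: infdist_def intro!: cINF_greatest)

text \<open>Moving \<open>y\<close> straight away from a nearest point of \<open>C\<close> by \<rho>
  would raise the distance by \<rho>. A nearest point may not exist, so \<open>le\<close> is proved
  for every \<open>c\<close> in \<open>C\<close> and the infimum over \<open>c\<close> is taken
  afterwards.\<close>

lemma infdist_add_radius_le:
  fixes C :: "'a::real_normed_vector set"
  assumes "C \<noteq> {}" "convex C" and pos: "infdist y C > 0" and "\<rho> \<ge> 0"
    and M: "\<And>z. dist z y \<le> \<rho> \<Longrightarrow> infdist z C \<le> M"
  shows "infdist y C + \<rho> \<le> M"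
proof -
  define d where "d = infdist y C"
  have le: "d * (\<rho> + dist y c) \<le> M * dist y c" if c: "c \<in> C" for c
  proof -
    define N where "N = dist y c"
    have "d \<le> N" unfolding d_def N_def by (rule infdist_le[OF c])
    with pos have N: "N > 0" by (simp add: d_def)
    \<comment> \<open>The point \<open>z\<close> lies on the ray from \<open>c\<close> through
      \<open>y\<close>, at distance \<rho> beyond \<open>y\<close>; \<open>t\<close> is the weight
      that makes \<open>y\<close> the combination of \<open>z\<close> and \<open>c\<close>.\<close>
    define t where "t = N / (N + \<rho>)"
    have t: "0 < t" "t \<le> 1" "1 - t = t * (\<rho> / N)"
      using N \<open>\<rho> \<ge> 0\<close> by (auto simp: t_def field_simps)
    define z where "z = y + (\<rho> / N) *\<^sub>R (y - c)"
    have z: "t *\<^sub>R z = y - (1 - t) *\<^sub>R c"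
    proof -
      have "t *\<^sub>R z = t *\<^sub>R y + (t * (\<rho> / N)) *\<^sub>R (y - c)"
        by (simp add: z_def scaleR_add_right)
      also have "\<dots> = t *\<^sub>R y + (1 - t) *\<^sub>R (y - c)"
        by (simp only: t(3))
      also have "\<dots> = y - (1 - t) *\<^sub>R c"
        by (simp add: algebra_simps)
      finally show ?thesis .
    qed
    have "d / t \<le> infdist z C"
    proof (rule infdist_greatest[OF \<open>C \<noteq> {}\<close>])
      fix c' assume c': "c' \<in> C"
      \<comment> \<open>The contraction with centre \<open>c\<close> and ratio \<open>t\<close> maps
        \<open>C\<close> into itself by convexity and takes \<open>z\<close> to
        \<open>y\<close>.\<close>
      have "t *\<^sub>R c' + (1 - t) *\<^sub>R c \<in> C"
        using t by (intro convexD[OF \<open>convex C\<close> c' c]) auto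
      then have "d \<le> dist y (t *\<^sub>R c' + (1 - t) *\<^sub>R c)"
        unfolding d_def by (rule infdist_le)
      also have "y - (t *\<^sub>R c' + (1 - t) *\<^sub>R c) = t *\<^sub>R (z - c')"
        using z by (simp add: algebra_simps)
      then have "dist y (t *\<^sub>R c' + (1 - t) *\<^sub>R c) = t * dist z c'"
        using t by (simp add: dist_norm)
      finally show "d / t \<le> dist z c'"
        using t by (simp add: field_simps)
    qed
    also have "\<dots> \<le> M"
      using N \<open>\<rho> \<ge> 0\<close> by (intro M) (simp add: z_def dist_norm N_def)
    finally show ?thesis
      using N \<open>\<rho> \<ge> 0\<close> by (simp add: t_def N_def field_simps)
  qed
  have "d \<le> M"
    unfolding d_def using \<open>\<rho> \<ge> 0\<close> by (intro M) simp
  show ?thesis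
  \<comment> \<open>\<open>le\<close> says \<open>d * \<rho> \<le> (M - d) * dist y c\<close>. If
    \<open>M = d\<close>, this forces \<rho> to vanish; otherwise divide by \<open>M - d\<close>,
    and the infimum over \<open>c\<close> turns \<open>dist y c\<close> into
    \<open>d\<close>.\<close>
  proof (cases "d = M")
    case True
    obtain c where "c \<in> C" using \<open>C \<noteq> {}\<close> by blast
    from le[OF this] True have "d * \<rho> \<le> 0" by (simp add: algebra_simps)
    with pos \<open>\<rho> \<ge> 0\<close> have "\<rho> = 0" by (simp add: d_def mult_le_0_iff)
    with True show ?thesis by (simp add: d_def)
  next
    case False
    with \<open>d \<le> M\<close> have s: "M - d > 0" by simp
    have "d * \<rho> / (M - d) \<le> d"
      unfolding d_def
    proof (rule infdist_greatest[OF \<open>C \<noteq> {}\<close>])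
      fix c assume "c \<in> C"
      from le[OF this] s show "infdist y C * \<rho> / (M - infdist y C) \<le> dist y c"
        by (simp add: d_def field_simps)
    qed
    with s have "d * \<rho> \<le> d * (M - d)" by (simp add: field_simps)
    with pos show ?thesis by (simp add: d_def)
  qed
qed

text \<open>Translation by \<open>c\<close> preserves distances and maps the convex cone into
  itself. This absorbs the summand \<open>C\<close> in the definition of metric increase.\<close>

lemma infdist_add_cone_le:
  fixes C :: "'a::real_normed_vector set"
  assumes "convex C" "cone C" "c \<in> C"
  shows "infdist (y + c) C \<le> infdist y C"
proof (rule infdist_greatest)
  fix c' assume "c' \<in> C"
  with assms have "c + c' \<in> C"
    using convex_cone[of C] by blast
  from infdist_le[OF this, of "y + c"] show "infdist (y + c) C \<le> dist y c'"
    by (simp add: dist_norm)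
qed (use assms in auto)

section \<open>The excess function and its decrease\<close>

lemma infdist_le_excess: "y \<in> F p x \<Longrightarrow> ereal (infdist y C) \<le> excess C F p x"
  unfolding excess_def by (rule SUP_upper)

text \<open>Nonemptiness matters, as a supremum over the empty set is minus infinity in
  \<open>ereal\<close>.\<close>

lemma excess_nonneg: "F p x \<noteq> {} \<Longrightarrow> 0 \<le> excess C F p x"
  using infdist_le_excess[of _ F p x C] infdist_nonneg[of _ C]
  by (metis all_not_in_conv ereal_less_eq(5) order_trans)

lemma excess_eq_0:
  assumes "F p x \<noteq> {}" "x \<in> sol C F p"
  shows "excess C F p x = 0"
proof -
  have "excess C F p x = (SUP y\<in>F p x. 0)"
    using assms(2) unfolding excess_def sol_def
    by (intro SUP_cong) (auto simp: zero_ereal_def)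
  with assms(1) show ?thesis by simp
qed

lemma excess_finite:
  assumes "bounded (F p x - C)"
  shows "excess C F p x < \<infinity>"
proof -
  obtain M where M: "\<And>y. y \<in> F p x - C \<Longrightarrow> infdist y C \<le> M" "M \<ge> 0"
  proof (cases "C = {}")
    case False
    then obtain c where c: "c \<in> C" by blast
    from assms obtain e where "\<And>y. y \<in> F p x - C \<Longrightarrow> dist c y \<le> e"
      unfolding bounded_any_center[of _ c] by blast
    \<comment> \<open>The maximum with 0 makes the bound also valid at points of \<open>C\<close>,
      where the distance is 0; \<open>e\<close> itself may be negative when \<open>F p x - C\<close>
      is empty.\<close>
    then have "infdist y C \<le> max e 0" if "y \<in> F p x - C" for y
      using that infdist_le[OF c, of y] by (fastforce simp: dist_commute)
    then show ?thesis by (intro that[of "max e 0"]) auto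
  qed (auto simp: infdist_def intro!: that[of 0])
  have "excess C F p x \<le> ereal M"
    unfolding excess_def
  proof (rule SUP_least)
    fix y assume "y \<in> F p x"
    with M show "ereal (infdist y C) \<le> ereal M"
      by (cases "y \<in> C") auto
  qed
  then show ?thesis by (auto intro: le_less_trans)
qed

text \<open>The left enlargement raises the excess at \<open>u\<close> by
  \<open>\<alpha> * r\<close>, while points of the right one are at distance at most
  \<open>excess C F p x + r\<close> from \<open>C\<close>. The hypothesis on \<open>u\<close> is
  essential: the enlargement of a subset of \<open>C\<close> may stay inside
  \<open>C\<close>.\<close>

lemma excess_decrease:
  fixes C :: "'y::real_normed_vector set"
  assumes ne: "F p u \<noteq> {}" "F p x \<noteq> {}" and C: "C \<noteq> {}" "closed C" "convex C" "cone C"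
    and "\<alpha> \<ge> 0" "r \<ge> 0"
    and sub: "enlarge (F p u) (\<alpha> * r) \<subseteq> enlarge (F p x + C) r"
    and u: "u \<notin> sol C F p"
  shows "excess C F p u + ereal (\<alpha> * r) \<le> excess C F p x + ereal r"
proof (cases "excess C F p x")
  case (real m)
  \<comment> \<open>The distance to \<open>C\<close> is 1-Lipschitz and at most \<open>m\<close> on
    \<open>F p x + C\<close>.\<close>
  have le: "infdist z C \<le> m + r" if z: "z \<in> enlarge (F p u) (\<alpha> * r)" for z
  proof -
    have "infdist z C - m \<le> infdist z (F p x + C)"
    proof (rule infdist_greatest)
      show "F p x + C \<noteq> {}" using ne C by (auto simp: set_plus_def)
      fix a assume "a \<in> F p x + C"
      then obtain y c where a: "a = y + c" "y \<in> F p x" "c \<in> C"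
        by (auto elim: set_plus_elim)
      have "infdist a C \<le> infdist y C"
        unfolding a(1) using C a by (intro infdist_add_cone_le)
      also have "\<dots> \<le> m"
        using infdist_le_excess[of y F p x C] a real by simp
      finally show "infdist z C - m \<le> dist z a"
        using infdist_triangle[of z C a] by simp
    qed
    also have "\<dots> \<le> r" using sub z by (auto simp: enlarge_def)
    finally show ?thesis by simp
  qed
  \<comment> \<open>The whole ball of radius \<open>\<alpha> * r\<close> around \<open>y\<close>
    lies in the enlargement of \<open>F p u\<close>, so \<open>le\<close> provides the bound needed
    in \<open>infdist_add_radius_le\<close>.\<close>
  have main: "infdist y C + \<alpha> * r \<le> m + r" if y: "y \<in> F p u" "y \<notin> C" for y
  proof (rule infdist_add_radius_le)
    show "infdist y C > 0"
      using y C by (simp add: infdist_pos_not_in_closed)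
    fix z assume "dist z y \<le> \<alpha> * r"
    with infdist_le[OF y(1), of z] show "infdist z C \<le> m + r"
      by (intro le) (simp add: enlarge_def)
  qed (use C assms in auto)
  \<comment> \<open>\<open>main\<close> says nothing about points of \<open>C\<close>. The value at
    \<open>y0\<close> shows that \<open>m + r - \<alpha> * r\<close> is nonnegative, which covers
    them.\<close>
  obtain y0 where y0: "y0 \<in> F p u" "y0 \<notin> C"
    using u by (auto simp: sol_def)
  have "excess C F p u \<le> ereal (m + r - \<alpha> * r)"
    unfolding excess_def
  proof (rule SUP_least)
    fix y assume y: "y \<in> F p u"
    show "ereal (infdist y C) \<le> ereal (m + r - \<alpha> * r)"
    proof (cases "y \<in> C")
      case True
      then have "infdist y C \<le> infdist y0 C" by (simp add: infdist_nonneg)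
      with main[OF y0] show ?thesis by simp
    next
      case False
      with main[of y] y show ?thesis by simp
    qed
  qed
  then show ?thesis
    using real by (cases "excess C F p u") auto
next
  case MInf
  then show ?thesis using excess_nonneg[of F p x C] ne by simp
qed simp

text \<open>Lower semicontinuity is tested with the open set \<open>- C\<close>.\<close>

lemma not_sol_eventually:
  assumes "lsc_at (F p) x" "closed C" "x \<notin> sol C F p"
  shows "\<forall>\<^sub>F u in nhds x. u \<notin> sol C F p"
proof -
  have "open (- C)" "F p x \<inter> - C \<noteq> {}"
    using assms by (auto simp: sol_def)
  then have "\<forall>\<^sub>F u in nhds x. F p u \<inter> - C \<noteq> {}"
    using assms(1) unfolding lsc_at_def by blast
  then show ?thesis by eventually_elim (auto simp: sol_def)
qed

section \<open>Lower bounds for strong slopes and outer slopes\<close>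

lemma strong_slope_ge:
  assumes fin: "\<bar>\<psi> x\<bar> \<noteq> \<infinity>" and "k > 0"
    and ev: "\<forall>\<^sub>F r in at_right 0. \<exists>u\<in>cball x r. \<psi> u + ereal (k * r) \<le> \<psi> x"
  shows "ereal k \<le> strong_slope \<psi> x"
proof -
  obtain m where m: "\<psi> x = ereal m" using fin by (cases "\<psi> x") auto
  have near: "\<exists>u. u \<noteq> x \<and> dist u x < e \<and> \<psi> u < \<psi> x \<and> ereal k \<le> (\<psi> x - \<psi> u) / ereal (norm (u - x))"
    if "e > 0" for e
  proof -
    have "\<forall>\<^sub>F r in at_right 0. r \<in> {0<..<e}"
      by (rule eventually_at_right_real[OF that])
    with ev have "\<forall>\<^sub>F r in at_right 0. r \<in> {0<..<e} \<and> (\<exists>u\<in>cball x r. \<psi> u + ereal (k * r) \<le> \<psi> x)"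
      by (rule eventually_elim2) blast
    from eventually_happens[OF this] obtain r u where
      r: "0 < r" "r < e" and u: "dist x u \<le> r" "\<psi> u + ereal (k * r) \<le> \<psi> x"
      by auto
    have kr: "k * r > 0" using r \<open>k > 0\<close> by simp
    have less: "\<psi> u < \<psi> x"
      using u(2) kr m by (cases "\<psi> u") auto
    then have "u \<noteq> x" by auto
    then have n: "norm (u - x) > 0" "norm (u - x) \<le> r"
      using u(1) by (auto simp: dist_norm norm_minus_commute)
    \<comment> \<open>The point \<open>u\<close> may be closer to \<open>x\<close> than
      \<open>r\<close>; this only enlarges the difference quotient.\<close>
    have kn: "k * norm (u - x) \<le> k * r" using n \<open>k > 0\<close> by simp
    have "ereal k \<le> (\<psi> x - \<psi> u) / ereal (norm (u - x))"
    proof (cases "\<psi> u")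
      case (real q)
      with u(2) m kn have "k * norm (u - x) \<le> m - q" by simp
      with n real m show ?thesis by (simp add: field_simps)
    qed (use less m n in auto)
    then show ?thesis
      using less \<open>u \<noteq> x\<close> u(1) r by (intro exI[of _ u]) (auto simp: dist_commute)
  qed
  \<comment> \<open>The points from \<open>near\<close> exclude the local minimizer case, where the
    slope is 0 by definition.\<close>
  have "\<not> (\<forall>\<^sub>F z in nhds x. \<psi> x \<le> \<psi> z)"
    using near by (force simp: eventually_nhds_metric not_le)
  moreover have "ereal k \<le> Limsup (at x) (\<lambda>z. (\<psi> x - \<psi> z) / ereal (norm (z - x)))"
    unfolding Limsup_def
  proof (rule INF_greatest)
    fix P assume "P \<in> {P. eventually P (at x)}"
    then obtain e where "e > 0" "\<And>z. z \<noteq> x \<Longrightarrow> dist z x < e \<Longrightarrow> P z"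
      by (auto simp: eventually_at)
    with near[of e] show "ereal k \<le> (SUP z\<in>{z. P z}. (\<psi> x - \<psi> z) / ereal (norm (z - x)))"
      by (blast intro: SUP_upper2)
  qed
  ultimately show ?thesis by (simp add: strong_slope_def)
qed

lemma strong_slope_excess_ge:
  fixes F :: "'p \<Rightarrow> 'x::real_normed_vector \<Rightarrow> 'y::real_normed_vector set"
  assumes ne: "\<And>x. F p x \<noteq> {}" and C: "C \<noteq> {}" "closed C" "convex C" "cone C"
    and lsc: "lsc_at (F p) x" and x: "x \<notin> sol C F p" and fin: "excess C F p x < \<infinity>"
    and \<alpha>: "\<alpha> > 1"
    and incr: "\<forall>\<^sub>F r in at_right 0. incr_step C (F p) \<alpha> x r"
  shows "ereal \<alpha> - 1 \<le> strong_slope (excess C F p) x"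
proof -
  obtain m where m: "excess C F p x = ereal m"
    using fin excess_nonneg[of F p x C, OF ne] by (cases "excess C F p x") auto
  \<comment> \<open>Radii below \<open>e\<close> keep all of \<open>cball x r\<close> outside the
    solution set, as \<open>excess_decrease\<close> requires.\<close>
  from not_sol_eventually[OF lsc \<open>closed C\<close> x] obtain e where
    e: "e > 0" "\<And>u. dist u x < e \<Longrightarrow> u \<notin> sol C F p"
    unfolding eventually_nhds_metric by blast
  have "\<forall>\<^sub>F r in at_right 0. r \<in> {0<..<e}"
    by (rule eventually_at_right_real[OF e(1)])
  with incr have "\<forall>\<^sub>F r in at_right 0.
      \<exists>u\<in>cball x r. excess C F p u + ereal ((\<alpha> - 1) * r) \<le> excess C F p x"
  proof eventually_elim
    case (elim r)
    then obtain u where u: "u \<in> cball x r" "enlarge (F p u) (\<alpha> * r) \<subseteq> enlarge (F p x + C) r"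
      by (auto simp: incr_step_def)
    with elim have "excess C F p u + ereal (\<alpha> * r) \<le> excess C F p x + ereal r"
      using \<alpha> C by (intro excess_decrease ne e) (auto simp: dist_commute)
    then have "excess C F p u + ereal ((\<alpha> - 1) * r) \<le> excess C F p x"
      using m by (cases "excess C F p u") (auto simp: algebra_simps)
    with u(1) show ?case by blast
  qed
  then have "ereal (\<alpha> - 1) \<le> strong_slope (excess C F p) x"
    using m \<alpha> by (intro strong_slope_ge) auto
  then show ?thesis by (simp add: one_ereal_def)
qed

text \<open>The limit is a supremum over all positive radii, so an estimate at one radius suffices
  for both outer slopes.\<close>

lemma INF_le_Lim_at_right_0:
  fixes g :: "'a \<Rightarrow> ereal" and A :: "real \<Rightarrow> 'a set"
  assumes mono: "\<And>a b. 0 < a \<Longrightarrow> a \<le> b \<Longrightarrow> A a \<subseteq> A b" and "\<epsilon> > 0"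
  shows "(INF x\<in>A \<epsilon>. g x) \<le> Lim (at_right 0) (\<lambda>\<epsilon>. INF x\<in>A \<epsilon>. g x)"
proof -
  have "((\<lambda>\<epsilon>. INF x\<in>A \<epsilon>. g x) \<longlongrightarrow> (SUP \<epsilon>\<in>{0<..}. INF x\<in>A \<epsilon>. g x)) (at_right 0)"
    by (intro tendsto_at_right_antimono_ereal INF_superset_mono mono) auto
  then have "Lim (at_right 0) (\<lambda>\<epsilon>. INF x\<in>A \<epsilon>. g x) = (SUP \<epsilon>\<in>{0<..}. INF x\<in>A \<epsilon>. g x)"
    by (intro tendsto_Lim) auto
  with \<open>\<epsilon> > 0\<close> show ?thesis by (auto intro: SUP_upper)
qed

lemma outer_slope_ge:
  assumes "\<epsilon> > 0"
    and "\<And>x. x \<in> cball xb \<epsilon> \<Longrightarrow> \<psi> xb < \<psi> x \<Longrightarrow> \<psi> x < \<psi> xb + ereal \<epsilon> \<Longrightarrow> k \<le> strong_slope \<psi> x"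
  shows "k \<le> outer_slope \<psi> xb"
proof -
  have "k \<le> (INF x\<in>{x \<in> cball xb \<epsilon>. \<psi> xb < \<psi> x \<and> \<psi> x < \<psi> xb + ereal \<epsilon>}. strong_slope \<psi> x)"
    using assms(2) by (intro INF_greatest) auto
  also have "\<dots> \<le> outer_slope \<psi> xb"
    unfolding outer_slope_def using \<open>\<epsilon> > 0\<close>
    by (intro INF_le_Lim_at_right_0)
      (auto intro: order_trans less_le_trans[OF _ add_left_mono])
  finally show ?thesis .
qed

lemma partial_outer_slope_ge:
  assumes "\<epsilon> > 0"
    and "\<And>p x. p \<in> cball pb \<epsilon> \<Longrightarrow> x \<in> cball xb \<epsilon> \<Longrightarrow> \<phi> pb xb < \<phi> p x \<Longrightarrow>
           \<phi> p x < \<phi> pb xb + ereal \<epsilon> \<Longrightarrow> k \<le> strong_slope (\<phi> p) x"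
  shows "k \<le> partial_outer_slope \<phi> pb xb"
proof -
  have "k \<le> (INF (p, x)\<in>{(p, x) \<in> cball pb \<epsilon> \<times> cball xb \<epsilon>.
                 \<phi> pb xb < \<phi> p x \<and> \<phi> p x < \<phi> pb xb + ereal \<epsilon>}. strong_slope (\<phi> p) x)"
    using assms(2) by (intro INF_greatest) auto
  also have "\<dots> \<le> partial_outer_slope \<phi> pb xb"
    unfolding partial_outer_slope_def using \<open>\<epsilon> > 0\<close>
    by (intro INF_le_Lim_at_right_0)
      (auto intro: order_trans less_le_trans[OF _ add_left_mono])
  finally show ?thesis .
qed

text \<open>Passes from single constants \<alpha> to the exact bound, which may be infinite; the 1
  is therefore moved to the other side before the supremum is taken.\<close>

lemma SUP_ereal_minus_1_bounds:
  assumes "A \<noteq> {}" "\<And>\<alpha>. \<alpha> \<in> A \<Longrightarrow> \<alpha> > 1" "\<And>\<alpha>. \<alpha> \<in> A \<Longrightarrow> ereal \<alpha> - 1 \<le> X"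
  shows "(SUP \<alpha>\<in>A. ereal \<alpha>) - 1 \<le> X \<and> (SUP \<alpha>\<in>A. ereal \<alpha>) - 1 > 0"
proof
  have "(SUP \<alpha>\<in>A. ereal \<alpha>) \<le> X + 1"
    using assms(3) by (intro SUP_least) (simp add: ereal_minus_le)
  then show "(SUP \<alpha>\<in>A. ereal \<alpha>) - 1 \<le> X"
    by (simp add: ereal_minus_le)
  obtain \<alpha> where "\<alpha> \<in> A" using assms(1) by blast
  with assms(2) have "1 < ereal \<alpha>" "ereal \<alpha> \<le> (SUP \<alpha>\<in>A. ereal \<alpha>)"
    by (auto simp: one_ereal_def intro: SUP_upper)
  then have "1 < (SUP \<alpha>\<in>A. ereal \<alpha>)" by (rule less_le_trans)
  then show "(SUP \<alpha>\<in>A. ereal \<alpha>) - 1 > 0"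
    by (cases "SUP \<alpha>\<in>A. ereal \<alpha>") (auto simp: one_ereal_def)
qed

theorem theorem5p7:
  fixes F :: "'p::metric_space \<Rightarrow> 'x::banach \<Rightarrow> 'y::banach set"
    and C :: "'y set" and pb :: 'p and xb :: 'x and \<delta> :: real
  assumes F_nonempty: "\<And>p x. F p x \<noteq> {}"
    and C: "C \<noteq> {}" "closed C" "convex C" "cone C"
    and xb: "xb \<in> sol C F pb"
    and \<delta>: "\<delta> > 0"
    and F_near: "\<And>p. p \<in> cball pb \<delta> \<Longrightarrow>
                   lsc (F p) \<and> concave_map (F p) \<and> bounded_valued_away C (F p)"
  shows "(metrically_increasing_uniform C F pb xb \<longrightarrow>
            partial_outer_slope (excess C F) pb xb \<ge> inc_uniform C F pb xb - 1 \<and>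
            inc_uniform C F pb xb - 1 > 0)
       \<and> (metrically_increasing_around C (F pb) xb \<longrightarrow>
            outer_slope (excess C F pb) xb \<ge> inc_around C (F pb) xb - 1 \<and>
            inc_around C (F pb) xb - 1 > 0)
       \<and> (metrically_increasing C (F pb) \<longrightarrow>
            tau C F pb \<ge> inc C (F pb) - 1 \<and>
            inc C (F pb) - 1 > 0)"
proof -
  \<comment> \<open>Common core of the three claims, which differ only in the pairs
    \<open>(p, x)\<close> considered and in the range \<open>d\<close> of admissible radii.\<close>
  have slope: "ereal \<alpha> - 1 \<le> strong_slope (excess C F p) x"
    if "p \<in> cball pb \<delta>" "x \<notin> sol C F p" "\<alpha> > 1" "d > 0"
      "\<And>r. r \<in> {0<..<d} \<Longrightarrow> incr_step C (F p) \<alpha> x r" for p x \<alpha> d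
  proof (rule strong_slope_excess_ge[OF _ C])
    show "F p x' \<noteq> {}" for x' by (rule F_nonempty)
    show "lsc_at (F p) x" using F_near[OF that(1)] by (simp add: lsc_def)
    show "excess C F p x < \<infinity>"
      using F_near[OF that(1)] by (intro excess_finite) (simp add: bounded_valued_away_def)
    show "\<forall>\<^sub>F r in at_right 0. incr_step C (F p) \<alpha> x r"
      using eventually_at_right_real[OF that(4)] by eventually_elim (rule that(5))
  qed fact+
  \<comment> \<open>The excess is 0 at \<open>(pb, xb)\<close>, so the strict inequality in the
    outer slopes leaves only points outside the solution set.\<close>
  have pos: "x \<notin> sol C F p" if "excess C F pb xb < excess C F p x" for p x
    using that excess_eq_0[of F pb xb C, OF F_nonempty xb] excess_eq_0[of F p x C, OF F_nonempty]
    by auto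
  have uniform: "ereal \<alpha> - 1 \<le> partial_outer_slope (excess C F) pb xb"
    if "\<alpha> \<in> incr_bounds_uniform C F pb xb" for \<alpha>
  proof -
    from that obtain d where d: "d > 0" "\<alpha> > 1"
      "\<And>p x r. p \<in> cball pb d \<Longrightarrow> x \<in> cball xb d \<Longrightarrow> r \<in> {0<..<d} \<Longrightarrow> incr_step C (F p) \<alpha> x r"
      unfolding incr_bounds_uniform_def by blast
    show ?thesis
    \<comment> \<open>Here \<open>d\<close> gives the increase condition and \<delta> the properties
      of \<open>F p\<close> for nearby \<open>p\<close>.\<close>
    proof (rule partial_outer_slope_ge[where \<epsilon> = "min d \<delta>"])
      fix p x assume "p \<in> cball pb (min d \<delta>)" "x \<in> cball xb (min d \<delta>)"
        "excess C F pb xb < excess C F p x"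
      then show "ereal \<alpha> - 1 \<le> strong_slope (excess C F p) x"
        using d by (intro slope[where d = d] pos d(3)) auto
    qed (use d \<delta> in auto)
  qed
  have around: "ereal \<alpha> - 1 \<le> outer_slope (excess C F pb) xb"
    if "\<alpha> \<in> incr_bounds_around C (F pb) xb" for \<alpha>
  proof -
    from that obtain d where d: "d > 0" "\<alpha> > 1"
      "\<And>x r. x \<in> cball xb d \<Longrightarrow> r \<in> {0<..<d} \<Longrightarrow> incr_step C (F pb) \<alpha> x r"
      unfolding incr_bounds_around_def by blast
    show ?thesis
    proof (rule outer_slope_ge[OF d(1)])
      fix x assume "x \<in> cball xb d" "excess C F pb xb < excess C F pb x"
      then show "ereal \<alpha> - 1 \<le> strong_slope (excess C F pb) x"
        using d \<delta> by (intro slope[where d = d] pos d(3)) auto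
    qed
  qed
  have global: "ereal \<alpha> - 1 \<le> tau C F pb" if "\<alpha> \<in> incr_bounds C (F pb)" for \<alpha>
    unfolding tau_def
  proof (rule INF_greatest)
    fix x assume "x \<in> UNIV - sol C F pb"
    with that \<delta> show "ereal \<alpha> - 1 \<le> strong_slope (excess C F pb) x"
      \<comment> \<open>The choice \<open>d = 1\<close> is arbitrary: the global condition holds for
        every positive radius.\<close>
      by (intro slope[where d = 1]) (auto simp: incr_bounds_def)
  qed
  show ?thesis
    unfolding metrically_increasing_uniform_def metrically_increasing_around_def
      metrically_increasing_def inc_uniform_def inc_around_def inc_def
    by (intro conjI[OF _ conjI] impI SUP_ereal_minus_1_bounds)
      (auto simp: uniform around global,
       auto simp: incr_bounds_uniform_def incr_bounds_around_def incr_bounds_def)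
qed

end
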